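(* For every $n\geq 2$, $\kappa^s(BH_n;K_{1,2})=n$.
   Context: The $n$-dimensional balanced hypercube $BH_n$ is the graph with vertex set $\{0,1,2,3\}^n$, vertices written $(a_0,a_1,\dots,a_{n-1})$, in which $(a_0,\dots,a_{n-1})$ is adjacent exactly to the $2n$ vertices $((a_0\pm 1)\bmod 4,a_1,\dots,a_{n-1})$ and, for each $1\le i\le n-1$, $((a_0\pm1)\bmod 4,a_1,\dots,a_{i-1},(a_i+(-1)^{a_0})\bmod 4,a_{i+1},\dots,a_{n-1})$. For a connected graph $G$ and a set $F$ of connected subgraphs of $G$, let $V(F)$ be the union of their vertex sets; $F$ is a subgraph-cut if $G-V(F)$ is disconnected or trivial. For a connected subgraph $H$ of $G$, an $H$-substructure-cut is a subgraph-cut each of whose elements is isomorphic to a connected subgraph of $H$, and $\kappa^s(G;H)$ is the minimum cardinality of an $H$-substructure-cut. $K_{1,2}$ is the star with two leaves (a path on three vertices). *)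

theory Defs
  imports "Graph_Theory.Graph_Theory" "HOL-Library.Extended_Nat"
begin

text \<open>
  Undirected simple graphs are the symmetric digraphs satisfying \<^const>\<open>graph\<close>. A vertex
  \<open>(a\<^sub>0, \<dots>, a\<^bsub>n-1\<^esub>)\<close> of the balanced hypercube is the list \<open>a\<close> with \<open>a ! i = a\<^sub>i\<close>; integer entries
  make \<open>a\<^sub>0 - 1\<close> and \<open>(-1)\<close> to the power \<open>a\<^sub>0\<close> meaningful before reduction modulo 4.
\<close>

definition bh_verts :: "nat \<Rightarrow> int list set" where
  "bh_verts n = {a. length a = n \<and> set a \<subseteq> {0, 1, 2, 3}}"

definition bh_neighbours :: "nat \<Rightarrow> int list \<Rightarrow> int list set" where
  "bh_neighbours n a =
     {a[0 := (a ! 0 + s) mod 4] | s. s \<in> {1, -1}} \<union>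
     {a[0 := (a ! 0 + s) mod 4, i := (a ! i + (-1) ^ nat (a ! 0)) mod 4] | s i.
        s \<in> {1, -1} \<and> 1 \<le> i \<and> i \<le> n - 1}"

definition balanced_hypercube :: "nat \<Rightarrow> int list pair_pre_digraph" where
  "balanced_hypercube n =
     \<lparr> pverts = bh_verts n, parcs = {(a, b). a \<in> bh_verts n \<and> b \<in> bh_neighbours n a} \<rparr>"

text \<open>
  \<^const>\<open>connected\<close> requires a nonempty vertex set, so a family covering all vertices also
  counts as a cut.
\<close>

definition subgraph_cut :: "('a, 'b) pre_digraph \<Rightarrow> ('a, 'b) pre_digraph set \<Rightarrow> bool" where
  "subgraph_cut G F \<longleftrightarrow>
     (\<forall>S\<in>F. graph S \<and> subgraph S G \<and> connected S) \<and>
     (let R = G \<restriction> (verts G - (\<Union>S\<in>F. verts S))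
      in \<not> connected R \<or> card (verts R) = 1)"

definition substructure_cut ::
  "('a, 'b) pre_digraph \<Rightarrow> ('c, 'd) pre_digraph \<Rightarrow> ('a, 'b) pre_digraph set \<Rightarrow> bool" where
  "substructure_cut G H F \<longleftrightarrow>
     subgraph_cut G F \<and>
     (\<forall>S\<in>F. \<exists>T. graph T \<and> subgraph T H \<and> connected T \<and> digraph_iso S T)"

text \<open>
  Valued in \<^typ>\<open>enat\<close> so that a graph without any cut has connectivity \<open>\<infinity>\<close>; otherwise the
  infimum is attained.
\<close>

definition substructure_connectivity ::
  "('a, 'b) pre_digraph \<Rightarrow> ('c, 'd) pre_digraph \<Rightarrow> enat" (\<open>\<kappa>\<^sup>s\<close>) where
  "substructure_connectivity G H =
     (INF F\<in>{F. finite F \<and> substructure_cut G H F}. enat (card F))"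

lemma finite_bh_verts: "finite (bh_verts n)"
proof -
  have "bh_verts n = {a. set a \<subseteq> {0, 1, 2, 3} \<and> length a = n}"
    by (auto simp: bh_verts_def)
  then show ?thesis
    by (simp add: finite_lists_length_eq)
qed

lemma bh_vertsD: "a \<in> bh_verts n \<Longrightarrow> i < n \<Longrightarrow> a ! i \<in> {0, 1, 2, 3}"
  unfolding bh_verts_def using nth_mem by blast

lemma bh_mod4: "(x::int) mod 4 \<in> {0, 1, 2, 3}"
proof -
  have "0 \<le> x mod 4" "x mod 4 < 4" by simp_all
  then show ?thesis by auto
qed

lemma bh_neighbours_subset:
  assumes "a \<in> bh_verts n"
  shows "bh_neighbours n a \<subseteq> bh_verts n"
proof -
  have upd: "b[i := x mod 4] \<in> bh_verts n" if "b \<in> bh_verts n" for b i and x :: int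
    using that set_update_subset_insert[of b i "x mod 4"] bh_mod4[of x]
    unfolding bh_verts_def by auto
  show ?thesis
    unfolding bh_neighbours_def using upd assms by blast
qed

lemma bh_step_back:
  fixes x s :: int
  assumes "x \<in> {0, 1, 2, 3}" "s \<in> {1, -1}"
  shows "((x + s) mod 4 + - s) mod 4 = x" "(x + s) mod 4 \<noteq> x"
    "y \<in> {0, 1, 2, 3} \<Longrightarrow>
      ((y + (-1) ^ nat x) mod 4 + (-1) ^ nat ((x + s) mod 4)) mod 4 = (y :: int)"
  using assms by (auto simp: numeral_eq_Suc)

lemma bh_neighbours_sym:
  assumes n: "n \<ge> 1" and a: "a \<in> bh_verts n" and b: "b \<in> bh_neighbours n a"
  shows "a \<in> bh_neighbours n b" "a \<noteq> b"
proof -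
  have len: "length a = n" using a by (simp add: bh_verts_def)
  have a0: "a ! 0 \<in> {0, 1, 2, 3}" using bh_vertsD[OF a] n by simp
  from b consider
      (one) s where "s \<in> {1, -1}" "b = a[0 := (a ! 0 + s) mod 4]"
    | (two) s i where "s \<in> {1, -1}" "1 \<le> i" "i \<le> n - 1"
        "b = a[0 := (a ! 0 + s) mod 4, i := (a ! i + (-1) ^ nat (a ! 0)) mod 4]"
    unfolding bh_neighbours_def by blast
  then have "a \<in> bh_neighbours n b \<and> a \<noteq> b"
  proof cases
    case one
    have b0: "b ! 0 = (a ! 0 + s) mod 4" using one n len by simp
    have "a = b[0 := (b ! 0 + - s) mod 4]"
      unfolding b0 bh_step_back(1)[OF a0 one(1)] using one by simp
    moreover have "- s \<in> {1, -1}" using one by auto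
    ultimately have "a \<in> bh_neighbours n b" unfolding bh_neighbours_def by blast
    moreover have "a \<noteq> b" using b0 bh_step_back(2)[OF a0 one(1)] by metis
    ultimately show ?thesis ..
  next
    case two
    have i: "i < n" "i \<noteq> 0" using two n by auto
    have ai: "a ! i \<in> {0, 1, 2, 3}" using bh_vertsD[OF a i(1)] .
    have b0: "b ! 0 = (a ! 0 + s) mod 4" using two n len i by simp
    have bi: "b ! i = (a ! i + (-1) ^ nat (a ! 0)) mod 4" using two len i by simp
    have "a = b[0 := (b ! 0 + - s) mod 4, i := (b ! i + (-1) ^ nat (b ! 0)) mod 4]"
      unfolding b0 bi bh_step_back(1)[OF a0 two(1)] bh_step_back(3)[OF a0 two(1) ai]
      unfolding two(4) using i by (simp add: list_update_swap)
    moreover have "- s \<in> {1, -1}" using two by auto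
    ultimately have "a \<in> bh_neighbours n b"
      unfolding bh_neighbours_def using two(2,3) by blast
    moreover have "a \<noteq> b" using b0 bh_step_back(2)[OF a0 two(1)] by metis
    ultimately show ?thesis ..
  qed
  then show "a \<in> bh_neighbours n b" "a \<noteq> b" by auto
qed

lemma pair_graph_balanced_hypercube:
  assumes "n \<ge> 1"
  shows "pair_graph (balanced_hypercube n)"
proof -
  let ?G = "balanced_hypercube n"
  have V: "pverts ?G = bh_verts n"
    by (simp add: balanced_hypercube_def)
  have E: "(a, b) \<in> parcs ?G \<longleftrightarrow> a \<in> bh_verts n \<and> b \<in> bh_neighbours n a" for a b
    by (simp add: balanced_hypercube_def)
  have snd: "b \<in> bh_verts n" if "(a, b) \<in> parcs ?G" for a b
    using that bh_neighbours_subset[of a n] E by blast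
  have sub: "parcs ?G \<subseteq> bh_verts n \<times> bh_verts n"
    using snd E by auto
  have sym: "sym (parcs ?G)"
  proof (rule symI)
    fix a b assume "(a, b) \<in> parcs ?G"
    then show "(b, a) \<in> parcs ?G"
      using snd bh_neighbours_sym(1)[OF assms] E by blast
  qed
  show ?thesis
  proof unfold_locales
    show "symmetric ?G"
      unfolding symmetric_def using sym by simp
    show "finite (pverts ?G)"
      unfolding V by (rule finite_bh_verts)
    show "finite (parcs ?G)"
      using finite_subset[OF sub] finite_bh_verts by blast
  next
    fix e assume e: "e \<in> parcs ?G"
    obtain a b where ab: "e = (a, b)" by fastforce
    show "fst e \<noteq> snd e"
      using e bh_neighbours_sym(2)[OF assms] E unfolding ab by simp
    show "fst e \<in> pverts ?G" "snd e \<in> pverts ?G"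
      using e sub unfolding ab V by auto
  qed
qed

end

theory Submission
  imports Defs
begin

text \<open>
  The vertices \<open>a\<close> and \<open>a[0 := a\<^sub>0 + 2]\<close> are twins, so \<open>BH\<^sub>n\<close> is a blow-up of an \<open>n\<close>-regular bipartite
  graph \<open>Q\<^bsub>n-1\<^esub>\<close> in which every vertex is replaced by two independent copies. The \<open>2 n\<close>
  neighbours of a vertex \<open>u\<close> form \<open>n\<close> pairs of twins, and each pair together with the twin of \<open>u\<close> as
  centre is a star; these \<open>n\<close> stars isolate \<open>u\<close>.

  Conversely, fewer than \<open>n\<close> connected graphs on at most three vertices contain at most \<open>2 (n - 1)\<close>
  vertices of each colour class and at most \<open>3 (n - 1)\<close> in total. A vertex of \<open>Q\<^bsub>n-1\<^esub>\<close> disappears only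
  if both its twins are deleted, so at most \<open>n - 1\<close> vertices disappear from each colour class and at
  most \<open>2 n - 3\<close> in total. Such a deletion leaves \<open>Q\<^bsub>n-1\<^esub>\<close> connected, by induction: \<open>Q\<^bsub>m+1\<^esub>\<close> is a cyclic
  arrangement of four copies of \<open>Q\<^sub>m\<close>, consecutive ones joined by a matching. At most one copy violates
  the induction hypothesis, the other copies hang together, and every vertex of a violating copy
  reaches one of them in at most two steps.
\<close>

subsection \<open>Deleting vertices from the quotient by twins\<close>

text \<open>
  A vertex \<open>(p, c)\<close> of the quotient stands for the twins \<open>x # c\<close> with \<open>odd x = p\<close>; its neighbours are
  the \<open>(\<not> p, d)\<close> with \<open>d \<in> quot_neighbours p c\<close>.
\<close>

definition shift :: "bool \<Rightarrow> int \<Rightarrow> int" where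
  "shift p j = (j + (if p then -1 else 1)) mod 4"

text \<open>The base case is the move that changes only \<open>a_0\<close>; each \<open>Cons\<close>
  adds the change of one further coordinate. This matches the splitting into four copies by the head
  \<open>j\<close>.\<close>

fun quot_neighbours :: "bool \<Rightarrow> int list \<Rightarrow> int list set" where
  "quot_neighbours p [] = {[]}"
| "quot_neighbours p (j # c) = insert (shift p j # c) ((#) j ` quot_neighbours p c)"

lemma shift_in: "shift p j \<in> {0, 1, 2, 3}"
  unfolding shift_def by (rule bh_mod4)

lemma shift_shift: "j \<in> {0, 1, 2, 3} \<Longrightarrow> shift (\<not> p) (shift p j) = j"
  by (cases p) (auto simp: shift_def)

lemma shift_neq: "j \<in> {0, 1, 2, 3} \<Longrightarrow> shift p j \<noteq> j"
  by (cases p) (auto simp: shift_def)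

lemma bh_verts_Nil: "[] \<in> bh_verts m \<longleftrightarrow> m = 0"
  by (auto simp: bh_verts_def)

lemma bh_verts_Cons: "j # c \<in> bh_verts (Suc m) \<longleftrightarrow> j \<in> {0, 1, 2, 3} \<and> c \<in> bh_verts m"
  by (auto simp: bh_verts_def)

lemma bh_verts_0: "bh_verts 0 = {[]}"
  by (auto simp: bh_verts_def)

lemma bh_verts_SucE:
  assumes "a \<in> bh_verts (Suc m)"
  obtains j c where "a = j # c" "j \<in> {0, 1, 2, 3}" "c \<in> bh_verts m"
  using assms by (cases a) (auto simp: bh_verts_Nil bh_verts_Cons)

lemma card_bh_verts: "card (bh_verts n) = 4 ^ n"
proof -
  have "bh_verts n = {a. set a \<subseteq> {0, 1, 2, 3} \<and> length a = n}"
    by (auto simp: bh_verts_def)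
  then show ?thesis
    by (simp add: card_lists_length_eq numeral_eq_Suc)
qed

lemma quot_neighbours_in_verts: "c \<in> bh_verts m \<Longrightarrow> c' \<in> quot_neighbours p c \<Longrightarrow> c' \<in> bh_verts m"
proof (induction c arbitrary: c' m)
  case (Cons j c)
  then show ?case using shift_in[of p j]
    by (cases m) (auto simp: bh_verts_Cons bh_verts_0)
qed simp

lemma quot_neighbours_sym: "c \<in> bh_verts m \<Longrightarrow> c' \<in> quot_neighbours p c \<Longrightarrow> c \<in> quot_neighbours (\<not> p) c'"
proof (induction c arbitrary: c' m)
  case (Cons j c)
  then show ?case using shift_shift[of j p]
    by (cases m) (auto simp: bh_verts_Cons bh_verts_0)
qed simp

text \<open>By \<open>shift_neq\<close> the neighbour that moves the head differs from those that
  keep it, so each coordinate adds one to the degree.\<close>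

lemma card_quot_neighbours: "c \<in> bh_verts m \<Longrightarrow> finite (quot_neighbours p c) \<and> card (quot_neighbours p c) = Suc m"
proof (induction c arbitrary: m)
  case (Cons j c)
  then obtain k where m: "m = Suc k" by (cases m) (auto simp: bh_verts_0)
  with Cons.prems have j: "j \<in> {0, 1, 2, 3}" and c: "c \<in> bh_verts k"
    by (auto simp: bh_verts_Cons)
  have "card ((#) j ` quot_neighbours p c) = Suc k" "finite ((#) j ` quot_neighbours p c)"
    using Cons.IH[OF c] by (auto simp: card_image)
  moreover have "shift p j # c \<notin> (#) j ` quot_neighbours p c"
    using shift_neq[OF j, of p] by auto
  ultimately show ?case by (simp add: m)
qed (simp add: bh_verts_Nil)

text \<open>Deletions are recorded per colour class, because the bounds of the induction are:
  \<open>D p\<close> is what class \<open>p\<close> loses.\<close>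

definition quot_edges :: "nat \<Rightarrow> (bool \<Rightarrow> int list set) \<Rightarrow> ((bool \<times> int list) \<times> (bool \<times> int list)) set" where
  "quot_edges m D = {((p, c), (\<not> p, c')) | p c c'.
     c \<in> bh_verts m \<and> c' \<in> quot_neighbours p c \<and> c \<notin> D p \<and> c' \<notin> D (\<not> p)}"

lemma sym_quot_edges: "sym (quot_edges m D)"
proof (rule symI)
  fix x y assume "(x, y) \<in> quot_edges m D"
  then obtain p c c' where *: "x = (p, c)" "y = (\<not> p, c')" "c \<in> bh_verts m" "c' \<in> quot_neighbours p c"
     "c \<notin> D p" "c' \<notin> D (\<not> p)"
    by (auto simp: quot_edges_def)
  then have "c' \<in> bh_verts m" "c \<in> quot_neighbours (\<not> p) c'" using quot_neighbours_in_verts quot_neighbours_sym by blast+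
  then show "(y, x) \<in> quot_edges m D" using * by (auto simp: quot_edges_def)
qed

abbreviation quot_reachable where
  "quot_reachable m D x y \<equiv> (x, y) \<in> (quot_edges m D)\<^sup>*"

lemma quot_reachable_sym: "quot_reachable m D x y \<Longrightarrow> quot_reachable m D y x"
  using sym_quot_edges sym_rtrancl by (metis symD)

text \<open>Prefixing \<open>j\<close> embeds \<open>Q_m\<close> as one of the four copies in
  \<open>Q_(m+1)\<close>, so walks that avoid the slice of \<open>D\<close> carry over.\<close>

lemma quot_reachable_slice:
  assumes "quot_reachable m (\<lambda>p. {c. j # c \<in> D p}) (p, c) (q, d)" and j: "j \<in> {0, 1, 2, 3}"
  shows "quot_reachable (Suc m) D (p, j # c) (q, j # d)"
  using assms(1)
proof (induction rule: rtrancl_induct2)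
  case refl
  show ?case by simp
next
  case (step a b a' b')
  have "((a, j # b), (a', j # b')) \<in> quot_edges (Suc m) D"
    using step(2) j by (auto simp: quot_edges_def bh_verts_Cons)
  with step(3) show ?case by (rule rtrancl_into_rtrancl)
qed

lemma card_slices:
  assumes "finite A" "j \<noteq> k"
  shows "card {c. j # c \<in> A} + card {c. k # c \<in> A} \<le> card A"
proof -
  have fin: "finite {c. i # c \<in> A}" for i
    using finite_vimageI[OF assms(1), of "(#) i"] by (simp add: vimage_def)
  have "card {c. j # c \<in> A} + card {c. k # c \<in> A}
      = card ((#) j ` {c. j # c \<in> A}) + card ((#) k ` {c. k # c \<in> A})"
    by (simp add: card_image)
  also have "\<dots> = card ((#) j ` {c. j # c \<in> A} \<union> (#) k ` {c. k # c \<in> A})"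
    using fin assms(2) by (subst card_Un_disjoint) auto
  also have "\<dots> \<le> card A"
    using assms(1) by (intro card_mono) auto
  finally show ?thesis .
qed

text \<open>
  For \<open>m = 0\<close> the truncated bound \<open>2 * m - 1\<close> is \<open>0\<close>: nothing is deleted, and the induction can start
  there.
\<close>

lemma quot_reachable_few_deleted:
  assumes "\<And>p. D p \<subseteq> bh_verts m" "\<And>p. card (D p) \<le> m"
    "card (D False) + card (D True) \<le> 2 * m - 1"
    "c \<in> bh_verts m" "d \<in> bh_verts m" "c \<notin> D p" "d \<notin> D q"
  shows "quot_reachable m D (p, c) (q, d)"
  using assms
proof (induction m arbitrary: D c d p q)
  case 0
  have "D r = {}" for r
    using 0(1)[of r] 0(2)[of r] finite_bh_verts[of 0] finite_subset by fastforce
  moreover have "c = []" "d = []" using 0 by (auto simp: bh_verts_0)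
  ultimately have "p \<noteq> q \<Longrightarrow> ((p, c), (q, d)) \<in> quot_edges 0 D"
    by (auto simp: quot_edges_def bh_verts_0)
  then show ?case using \<open>c = []\<close> \<open>d = []\<close> by (cases "p = q") auto
next
  case (Suc m)
  \<comment> \<open>\<open>S j\<close> is the deletion seen inside copy \<open>j\<close>,
    \<open>good j\<close> says that the induction hypothesis applies to it, and \<open>U j\<close>
    holds its survivors.\<close>
  define S where "S j p = {c. j # c \<in> D p}" for j p
  define good where "good j \<longleftrightarrow> (\<forall>p. card (S j p) \<le> m) \<and> card (S j False) + card (S j True) \<le> 2 * m - 1"
    for j
  define U where "U j = {(p, j # c) | p c. c \<in> bh_verts m \<and> c \<notin> S j p}" for j
  have fin: "finite (D p)" for p
    using Suc.prems(1) finite_bh_verts finite_subset by blast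
  have S_sub: "S j p \<subseteq> bh_verts m" for j p
    using Suc.prems(1)[of p] by (auto simp: S_def bh_verts_Cons)
  have finS: "finite (S j p)" for j p
    using S_sub finite_bh_verts finite_subset by blast
  have slices: "card (S j p) + card (S k p) \<le> card (D p)" if "j \<noteq> k" for j k p
    unfolding S_def using card_slices[OF fin that] .
  have Dm: "card (D p) \<le> Suc m" "card (D p) + card (D (\<not> p)) \<le> Suc (2 * m)" for p
    using Suc.prems(2)[of p] Suc.prems(3) by (cases p; simp)+
  have pow: "2 * m < 4 ^ m" by (induction m) auto
  \<comment> \<open>At most \<open>2 * m + 1\<close> vertices are deleted. For
    \<open>m \<ge> 1\<close> a bad copy loses either all \<open>m + 1\<close> deletions of one
    class, which leaves at most \<open>m\<close> of the other, or at least \<open>2 * m\<close>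
    vertices, which leaves at most one; both remainders are good. For \<open>m = 0\<close> a bad
    copy uses up the only deletion.\<close>
  have good_bad: "good k" if "\<not> good j" "k \<noteq> j" for j k
  proof -
    have le: "card (S k p) + card (S j p) \<le> card (D p)" for p
      using slices that(2) by simp
    show ?thesis
      using that(1) le[of True] le[of False] Dm[of True] Dm[of False]
      unfolding good_def all_bool_eq by (cases m) auto
  qed
  have within: "quot_reachable (Suc m) D x y" if "good j" "j \<in> {0, 1, 2, 3}" "x \<in> U j" "y \<in> U j" for j x y
  proof -
    from that obtain p c q d where x: "x = (p, j # c)" "c \<in> bh_verts m" "c \<notin> S j p"
      and y: "y = (q, j # d)" "d \<in> bh_verts m" "d \<notin> S j q"
      by (auto simp: U_def)
    have "quot_reachable m (S j) (p, c) (q, d)"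
      using that(1) x y S_sub by (intro Suc.IH) (auto simp: good_def)
    then show ?thesis
      unfolding x y S_def using that(2) by (rule quot_reachable_slice)
  qed
  \<comment> \<open>Class \<open>False\<close> of copy \<open>j\<close> is matched to class
    \<open>True\<close> of the next copy by \<open>4 ^ m\<close> edges, and at most
    \<open>2 * m\<close> of them are hit.\<close>
  have link: "\<exists>x\<in>U j. \<exists>y\<in>U (shift False j). quot_reachable (Suc m) D x y"
    if "good j" "good (shift False j)" "j \<in> {0, 1, 2, 3}" for j
  proof -
    let ?k = "shift False j"
    have "card (S j False \<union> S ?k True) \<le> card (S j False) + card (S ?k True)"
      by (rule card_Un_le)
    also have "\<dots> \<le> m + m"
      using that by (intro add_mono) (auto simp: good_def)
    also have "\<dots> < card (bh_verts m)" using pow by (simp add: card_bh_verts)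
    finally have "\<not> bh_verts m \<subseteq> S j False \<union> S ?k True"
      using card_mono[of "S j False \<union> S ?k True" "bh_verts m"] finS by auto
    then obtain c where c: "c \<in> bh_verts m" "c \<notin> S j False" "c \<notin> S ?k True" by blast
    have "((False, j # c), (True, ?k # c)) \<in> quot_edges (Suc m) D"
      using c that(3) by (auto simp: quot_edges_def S_def bh_verts_Cons)
    moreover have "(False, j # c) \<in> U j" "(True, ?k # c) \<in> U ?k"
      using c by (auto simp: U_def)
    ultimately show ?thesis by blast
  qed
  have adj: "quot_reachable (Suc m) D x y"
    if "good j" "good k" "j \<in> {0, 1, 2, 3}" "k \<in> {0, 1, 2, 3}" "k = shift False j \<or> j = shift False k"
      "x \<in> U j" "y \<in> U k" for j k x y
    using that(5)
  proof
    note asm = that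
    assume k: "k = shift False j"
    then obtain x' y' where "x' \<in> U j" "y' \<in> U k" and *: "quot_reachable (Suc m) D x' y'"
      using link[of j] asm(1,2,3) by blast
    then have "quot_reachable (Suc m) D x x'" "quot_reachable (Suc m) D y' y"
      using within[of j] within[of k] that by blast+
    then show ?thesis
      using * by (meson rtrancl_trans)
  next
    note asm = that
    assume k: "j = shift False k"
    then obtain x' y' where "x' \<in> U k" "y' \<in> U j" and *: "quot_reachable (Suc m) D x' y'"
      using link[of k] asm(1,2,4) by blast
    then have "quot_reachable (Suc m) D x y'" "quot_reachable (Suc m) D x' y"
      using within[of j] within[of k] that by blast+
    then show ?thesis
      using quot_reachable_sym[OF *] by (meson rtrancl_trans)
  qed
  have between: "quot_reachable (Suc m) D x y"
    if "good j" "good k" "j \<in> {0, 1, 2, 3}" "k \<in> {0, 1, 2, 3}" "x \<in> U j" "y \<in> U k" for j k x y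
  proof -
    have "j = k \<or> (k = shift False j \<or> j = shift False k) \<or>
        k \<noteq> j \<and> k = shift False (shift False j) \<and> j = shift False (shift False k)"
      using that(3,4) by (elim insertE emptyE) (simp_all add: shift_def)
    then consider "j = k" | "k = shift False j \<or> j = shift False k"
      | "k \<noteq> j" "k = shift False (shift False j)" "j = shift False (shift False k)"
      by argo
    then show ?thesis
    proof cases
      \<comment> \<open>Opposite copies: each of the two remaining copies is adjacent to both, and
        at most one of these is bad. The walk passes through the other.\<close>
      case 3
      have "shift False j \<noteq> shift False k"
        using 3 by metis
      then have "good (shift False j) \<or> good (shift False k)"
        using good_bad[of "shift False j" "shift False k"] by metis
      then obtain i where i: "good i" "i \<in> {0, 1, 2, 3}"
        and ij: "i = shift False j \<or> j = shift False i" and ik: "k = shift False i \<or> i = shift False k"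
        using 3(2,3) shift_in by blast
      have "card (S i True) < card (bh_verts m)"
        using i(1) pow unfolding good_def card_bh_verts by (metis le_less_trans mult_2 le_add1 le_trans)
      then obtain c where "c \<in> bh_verts m" "c \<notin> S i True"
        using S_sub[of i True] by (metis card_mono finS leD subsetI)
      then have "(True, i # c) \<in> U i" by (auto simp: U_def)
      then have "quot_reachable (Suc m) D x (True, i # c)" "quot_reachable (Suc m) D (True, i # c) y"
        using adj[of j i] adj[of i k] i ij ik that by blast+
      then show ?thesis by (rule rtrancl_trans)
    qed (use within adj that in blast)+
  qed
  have escape: "\<exists>k y. k \<in> {0, 1, 2, 3} \<and> good k \<and> y \<in> U k \<and> quot_reachable (Suc m) D (p, a) y"
    if "a \<in> bh_verts (Suc m)" "a \<notin> D p" for p a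
  proof -
    from that(1) obtain j c where a: "a = j # c" and j: "j \<in> {0, 1, 2, 3}" and c: "c \<in> bh_verts m"
      by (rule bh_verts_SucE)
    have aU: "(p, a) \<in> U j" using that a c by (auto simp: U_def S_def)
    show ?thesis
    proof (cases "good j")
      case True
      then show ?thesis using aU j by blast
    next
      case False
      \<comment> \<open>Each vertex has one edge leaving its copy, and out of the bad copy it leads
        to a good one.\<close>
      have out: "\<exists>y\<in>U (shift r j). quot_reachable (Suc m) D (r, j # b) y"
        if "b \<in> bh_verts m" "j # b \<notin> D r" "shift r j # b \<notin> D (\<not> r)" for r b
      proof
        show "(\<not> r, shift r j # b) \<in> U (shift r j)"
          using that by (auto simp: U_def S_def)
        show "quot_reachable (Suc m) D (r, j # b) (\<not> r, shift r j # b)"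
          using that j by (intro r_into_rtrancl) (auto simp: quot_edges_def bh_verts_Cons)
      qed
      have gs: "good (shift r j)" "shift r j \<in> {0, 1, 2, 3}" for r
        using good_bad[OF False] shift_neq[OF j] shift_in by blast+
      \<comment> \<open>A deleted outer neighbour lies outside copy \<open>j\<close>, so it spends
        one deletion of its class elsewhere.\<close>
      have dead: "card (S j (\<not> r)) < card (D (\<not> r))" if "shift r j # b \<in> D (\<not> r)" for r b
      proof -
        have "b \<in> S (shift r j) (\<not> r)" using that by (simp add: S_def)
        then have "card (S (shift r j) (\<not> r)) > 0"
          using finS card_gt_0_iff by blast
        then show ?thesis
          using slices[of "shift r j" j "\<not> r"] shift_neq[OF j, of r] by simp
      qed
      show ?thesis
      proof (cases "shift p j # c \<in> D (\<not> p)")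
        case False
        then show ?thesis using out[of c p] gs c that a by blast
      next
        \<comment> \<open>The direct exit is blocked, so copy \<open>j\<close> has lost at most
          \<open>m\<close> vertices of the opposite class. One of the \<open>m + 1\<close>
          neighbours of \<open>c\<close> inside the copy survives, and its exit is tried
          next.\<close>
        case True
        note d1 = dead[OF True]
        then have "card (S j (\<not> p)) < card (quot_neighbours p c)"
          using card_quot_neighbours[OF c, of p] Dm(1)[of "\<not> p"] by simp
        then obtain b where b: "b \<in> quot_neighbours p c" "b \<notin> S j (\<not> p)"
          by (metis card_mono finS leD subsetI)
        then have bv: "b \<in> bh_verts m" using c quot_neighbours_in_verts by blast
        have st: "quot_reachable (Suc m) D (p, a) (\<not> p, j # b)"
          using b that a j c by (intro r_into_rtrancl) (auto simp: quot_edges_def bh_verts_Cons S_def)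
        have "shift (\<not> p) j # b \<notin> D (\<not> \<not> p)"
        proof
          assume "shift (\<not> p) j # b \<in> D (\<not> \<not> p)"
          then have "card (S j p) < card (D p)" using dead by fastforce
          then have "good j"
            unfolding good_def all_bool_eq using d1 Dm[of p] Dm[of "\<not> p"] by (cases p) auto
          then show False using \<open>\<not> good j\<close> by blast
        qed
        then obtain y where "y \<in> U (shift (\<not> p) j)" "quot_reachable (Suc m) D (\<not> p, j # b) y"
          using out[of b "\<not> p"] bv b by (auto simp: S_def)
        then show ?thesis using st gs by (meson rtrancl_trans)
      qed
    qed
  qed
  obtain j x where x: "j \<in> {0, 1, 2, 3}" "good j" "x \<in> U j" "quot_reachable (Suc m) D (p, c) x"
    using escape[OF Suc.prems(4,6)] by metis
  obtain k y where y: "k \<in> {0, 1, 2, 3}" "good k" "y \<in> U k" "quot_reachable (Suc m) D (q, d) y"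
    using escape[OF Suc.prems(5,7)] by metis
  have "quot_reachable (Suc m) D x y" using between[OF x(2) y(2) x(1) y(1) x(3) y(3)] .
  with x(4) have "quot_reachable (Suc m) D (p, c) y" by (rule rtrancl_trans)
  then show ?case using quot_reachable_sym[OF y(4)] by (rule rtrancl_trans)
qed

subsection \<open>The lower bound\<close>

lemma quot_neighbours_eq: "quot_neighbours p c = insert c ((\<lambda>i. c[i := shift p (c ! i)]) ` {..<length c})"
  by (induction c) (simp_all add: lessThan_Suc_eq_insert_0 image_image insert_commute)

lemma shift_odd: "x \<in> {0, 1, 2, 3} \<Longrightarrow> (y + (-1) ^ nat x) mod 4 = shift (odd x) y"
  by (auto simp: shift_def numeral_eq_Suc)

text \<open>Both residues of the other parity are one step away modulo 4, so the head enters
  adjacency only through its parity. This is the source of the twins.\<close>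

lemma mod4_odd_neq:
  fixes x y :: int
  assumes "x \<in> {0, 1, 2, 3}" "y \<in> {0, 1, 2, 3}"
  shows "(\<exists>s\<in>{1, -1}. y = (x + s) mod 4) \<longleftrightarrow> odd x \<noteq> odd y"
  using assms by (elim insertE emptyE) simp_all

text \<open>The two sets in \<open>bh_neighbours\<close> correspond to the two parts of
  \<open>quot_neighbours_eq\<close>; position \<open>Suc k\<close> of the vertex is position
  \<open>k\<close> of its tail.\<close>

lemma bh_neighbours_Cons:
  assumes x: "x \<in> {0, 1, 2, 3}" and y: "y \<in> {0, 1, 2, 3}" and c: "c \<in> bh_verts m"
  shows "y # d \<in> bh_neighbours (Suc m) (x # c) \<longleftrightarrow> odd x \<noteq> odd y \<and> d \<in> quot_neighbours (odd x) c"
proof -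
  have len: "length c = m" using c by (simp add: bh_verts_def)
  have 1: "y # d \<in> {(x # c)[0 := ((x # c) ! 0 + s) mod 4] | s. s \<in> {1, -1}}
      \<longleftrightarrow> (\<exists>s\<in>{1, -1}. y = (x + s) mod 4) \<and> d = c"
    by (simp only: list_update_code(2) nth_Cons_0 mem_Collect_eq list.inject) blast
  have 2: "y # d \<in> {(x # c)[0 := ((x # c) ! 0 + s) mod 4,
        i := ((x # c) ! i + (-1) ^ nat ((x # c) ! 0)) mod 4] | s i. s \<in> {1, -1} \<and> 1 \<le> i \<and> i \<le> Suc m - 1}
      \<longleftrightarrow> (\<exists>s\<in>{1, -1}. y = (x + s) mod 4) \<and> (\<exists>i<m. d = c[i := shift (odd x) (c ! i)])"
    (is "?L \<longleftrightarrow> ?R")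
  proof
    assume ?L
    then obtain s i where *: "s \<in> {1, -1}" "1 \<le> i" "i \<le> Suc m - 1"
      "y # d = (x # c)[0 := ((x # c) ! 0 + s) mod 4,
        i := ((x # c) ! i + (-1) ^ nat ((x # c) ! 0)) mod 4]"
      unfolding mem_Collect_eq by metis
    then obtain k where "i = Suc k" "k < m" by (cases i) auto
    with * show ?R using shift_odd[OF x] by auto
  next
    assume ?R
    then obtain s i where *: "s \<in> {1, -1}" "y = (x + s) mod 4" "i < m"
      "d = c[i := shift (odd x) (c ! i)]"
      by metis
    then have "y # d = (x # c)[0 := ((x # c) ! 0 + s) mod 4,
        Suc i := ((x # c) ! Suc i + (-1) ^ nat ((x # c) ! 0)) mod 4]"
      using shift_odd[OF x] by simp
    moreover have "1 \<le> Suc i" "Suc i \<le> Suc m - 1" using * by auto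
    ultimately show ?L using *(1) by blast
  qed
  show ?thesis
    unfolding bh_neighbours_def Un_iff 1 2 mod4_odd_neq[OF x y] quot_neighbours_eq using len by auto
qed

lemma parcs_balanced_hypercube:
  "(x # c, y # d) \<in> parcs (balanced_hypercube (Suc m)) \<longleftrightarrow>
    x # c \<in> bh_verts (Suc m) \<and> y # d \<in> bh_verts (Suc m) \<and> odd x \<noteq> odd y \<and> d \<in> quot_neighbours (odd x) c"
proof (cases "x # c \<in> bh_verts (Suc m) \<and> y # d \<in> bh_verts (Suc m)")
  case True
  then show ?thesis
    using bh_neighbours_Cons[of x y c m d] by (auto simp: balanced_hypercube_def bh_verts_Cons)
next
  case False
  then show ?thesis
    using bh_neighbours_subset[of "x # c" "Suc m"] by (auto simp: balanced_hypercube_def)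
qed

lemma parcs_balanced_hypercube_odd_hd:
  assumes "(a, b) \<in> parcs (balanced_hypercube (Suc m))"
  shows "odd (hd a) \<noteq> odd (hd b)"
proof -
  have "a \<in> bh_verts (Suc m)" "b \<in> bh_verts (Suc m)"
    using assms bh_neighbours_subset by (auto simp: balanced_hypercube_def)
  then obtain x c y d where "a = x # c" "b = y # d"
    by (metis bh_verts_SucE)
  then show ?thesis using assms by (simp add: parcs_balanced_hypercube)
qed

section \<open>Deletions in the balanced hypercube and their trace on the quotient\<close>

definition covered :: "nat \<Rightarrow> int list set \<Rightarrow> bool \<Rightarrow> int list set" where
  "covered m S p = {c \<in> bh_verts m. \<forall>x\<in>{0, 1, 2, 3}. odd x = p \<longrightarrow> x # c \<in> S}"

text \<open>Each covered vertex accounts for its own pair of twins in \<open>S\<close>.\<close>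

lemma card_covered:
  assumes "finite S"
  shows "2 * card (covered m S p) \<le> card {a \<in> S. odd (hd a) = p}"
proof -
  let ?X = "{x \<in> {0, 1, 2, 3::int}. odd x = p}"
  have "?X = (if p then {1, 3} else {0, 2})" by auto
  then have "card ?X = 2" by simp
  then have "2 * card (covered m S p) = card (?X \<times> covered m S p)"
    by (simp add: card_cartesian_product)
  also have "\<dots> = card ((\<lambda>(x, c). x # c) ` (?X \<times> covered m S p))"
    by (rule card_image[symmetric]) (auto simp: inj_on_def)
  also have "\<dots> \<le> card {a \<in> S. odd (hd a) = p}"
    using assms by (intro card_mono) (auto simp: covered_def)
  finally show ?thesis .
qed

text \<open>A walk in the quotient lifts by choosing any surviving twin at each step, since
  adjacency does not depend on the choice.\<close>

lemma connected_delete_balanced_hypercube: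
  fixes S :: "int list set"
  assumes S: "S \<subset> bh_verts (Suc m)" and D: "\<And>p. card (covered m S p) \<le> m"
    "card (covered m S False) + card (covered m S True) \<le> 2 * m - 1"
  defines "R \<equiv> with_proj (balanced_hypercube (Suc m)) \<restriction> (bh_verts (Suc m) - S)"
  shows "connected R" "card (verts R) \<noteq> 1"
proof -
  let ?V = "bh_verts (Suc m) - S" and ?D = "covered m S"
  interpret G: pair_graph "balanced_hypercube (Suc m)"
    by (rule pair_graph_balanced_hypercube) simp
  interpret R: wf_digraph R unfolding R_def by (rule G.wellformed_induce_subgraph)
  have finD: "finite (?D p)" for p
    unfolding covered_def using finite_bh_verts by simp
  have V: "verts R = ?V" by (simp add: R_def)
  have E: "(x # c) \<rightarrow>\<^bsub>R\<^esub> (y # d) \<longleftrightarrow> x # c \<in> ?V \<and> y # d \<in> ?V \<and> odd x \<noteq> odd y \<and> d \<in> quot_neighbours (odd x) c"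
    for x c y d
    using parcs_balanced_hypercube[of x c y d m] by (auto simp: R_def arcs_ends_conv image_iff)
  have alive: "c \<in> bh_verts m" "c \<notin> ?D (odd x)" if "x # c \<in> ?V" for x c
    using that by (auto simp: bh_verts_Cons covered_def)
  have rep: "\<exists>x. odd x = p \<and> x # c \<in> ?V" if "c \<in> bh_verts m" "c \<notin> ?D p" for c p
  proof -
    note c = that
    obtain x where "x \<in> {0, 1, 2, 3}" "odd x = p" "x # c \<notin> S"
      using c unfolding covered_def mem_Collect_eq by metis
    then show ?thesis using c by (auto simp: bh_verts_Cons)
  qed
  have nbr: "\<exists>y d. y # d \<in> ?V \<and> odd x \<noteq> odd y \<and> d \<in> quot_neighbours (odd x) c" if "x # c \<in> ?V" for x c
  proof -
    have "card (?D (\<not> odd x)) < card (quot_neighbours (odd x) c)"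
      using D(1)[of "\<not> odd x"] card_quot_neighbours[OF alive(1)[OF that], of "odd x"] by simp
    then obtain d where d: "d \<in> quot_neighbours (odd x) c" "d \<notin> ?D (\<not> odd x)"
      by (metis card_mono finD leD subsetI)
    moreover have "d \<in> bh_verts m"
      using d(1) alive(1)[OF that] quot_neighbours_in_verts by blast
    ultimately show ?thesis using rep[of d "\<not> odd x"] by blast
  qed
  have lift: "\<exists>y. odd y = q \<and> y # d \<in> ?V \<and> (x # c) \<rightarrow>\<^sup>*\<^bsub>R\<^esub> (y # d)"
    if "quot_reachable m ?D (odd x, c) (q, d)" "x # c \<in> ?V" for x c q d
    using that(1)
  proof (induction rule: rtrancl_induct2)
    case refl
    show ?case using that(2) V by blast
  next
    case (step p b q d)
    then have *: "q = (\<not> p)" "d \<in> quot_neighbours p b" "d \<in> bh_verts m" "d \<notin> ?D q"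
      using quot_neighbours_in_verts by (auto simp: quot_edges_def)
    from step.IH obtain y where y: "odd y = p" "y # b \<in> ?V" "(x # c) \<rightarrow>\<^sup>*\<^bsub>R\<^esub> (y # b)" by blast
    obtain z where z: "odd z = q" "z # d \<in> ?V" using rep * by blast
    then have "(y # b) \<rightarrow>\<^bsub>R\<^esub> (z # d)" using y * by (auto simp: E)
    with y(3) have "(x # c) \<rightarrow>\<^sup>*\<^bsub>R\<^esub> (z # d)" by (rule R.reachable_adj_trans)
    then show ?case using z by blast
  qed
  have V_Cons: "\<exists>x c. a = x # c" if "a \<in> ?V" for a
    using that by (metis DiffD1 bh_verts_SucE)
  show "connected R"
  proof (rule R.connectedI)
    show "verts R \<noteq> {}" using S by (auto simp: V)
    fix u v assume "u \<in> verts R" "v \<in> verts R"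
    then obtain x c y d where u: "u = x # c" "x # c \<in> ?V" and v: "v = y # d" "y # d \<in> ?V"
      using V_Cons V by metis
    \<comment> \<open>A lifted walk ends at an uncontrolled twin, so it is aimed at a neighbour of
      \<open>v\<close> instead of \<open>v\<close>: either twin of that neighbour is adjacent to
      \<open>v\<close>.\<close>
    obtain z e where z: "z # e \<in> ?V" "odd y \<noteq> odd z" "e \<in> quot_neighbours (odd y) d"
      using nbr[OF v(2)] by blast
    have "quot_reachable m ?D (odd x, c) (odd z, e)"
      using alive[OF u(2)] alive[OF z(1)] D by (intro quot_reachable_few_deleted) (auto simp: covered_def)
    from lift[OF this u(2)] obtain w where w: "odd w = odd z" "w # e \<in> ?V" "u \<rightarrow>\<^sup>*\<^bsub>R\<^esub> (w # e)"
      using u by blast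
    have "d \<in> quot_neighbours (\<not> odd y) e" using quot_neighbours_sym[OF alive(1)[OF v(2)] z(3)] .
    then have "(w # e) \<rightarrow>\<^bsub>R\<^esub> v" using w z v by (auto simp: E)
    with w(3) have "u \<rightarrow>\<^sup>*\<^bsub>R\<^esub> v" by (rule R.reachable_adj_trans)
    then show "u \<rightarrow>\<^sup>*\<^bsub>mk_symmetric R\<^esub> v" by (rule R.reachable_mk_symmetricI)
  qed
  show "card (verts R) \<noteq> 1"
  proof
    assume "card (verts R) = 1"
    then obtain u where u: "?V = {u}" unfolding V by (rule card_1_singletonE)
    then obtain x c where "u = x # c" using V_Cons by blast
    with u nbr[of x c] show False by auto
  qed
qed

section \<open>Counting the vertices of substructures\<close>

lemma card_verts_substructure:
  assumes "digraph_iso S T" "subgraph T H" "finite (verts H)"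
  shows "card (verts S) \<le> card (verts H)"
proof -
  obtain f where f: "pre_digraph.digraph_isomorphism S f" "T = app_iso f S"
    using assms(1) by (auto simp: digraph_iso_def)
  then have "card (verts T) = card (verts S)"
    by (simp add: card_image pre_digraph.digraph_isomorphism_inj_on_verts)
  moreover have "card (verts T) \<le> card (verts H)"
    using assms(2,3) by (intro card_mono) auto
  ultimately show ?thesis by simp
qed

lemma connected_no_arcs:
  assumes "connected S" "arcs S = {}" "u \<in> verts S" "v \<in> verts S"
  shows "u = v"
proof -
  have "(u, v) \<in> rtrancl_on (verts S) ((arcs_ends S)\<^sup>s)"
    using assms by (simp add: connected_conv)
  then have "(u, v) \<in> ((arcs_ends S)\<^sup>s)\<^sup>*" by (rule rtrancl_on_rtranclI)
  moreover have "(arcs_ends S)\<^sup>s = {}" using assms(2) by (simp add: symcl_def arcs_ends_conv)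
  ultimately show ?thesis by simp
qed

text \<open>Arcs change the parity of the head. Three vertices of one class would be all of
  \<open>S\<close>, without any arc, against connectedness.\<close>

lemma card_odd_hd_substructure:
  assumes S: "subgraph S (with_proj (balanced_hypercube (Suc m)))" "connected S"
    and fin: "finite (verts S)" and card: "card (verts S) \<le> 3"
  shows "card {a \<in> verts S. odd (hd a) = p} \<le> 2"
proof (rule ccontr)
  assume "\<not> ?thesis"
  then have "card (verts S) \<le> card {a \<in> verts S. odd (hd a) = p}"
    and c3: "card {a \<in> verts S. odd (hd a) = p} \<ge> 3"
    using card by auto
  then have eq: "{a \<in> verts S. odd (hd a) = p} = verts S"
    by (intro card_subset_eq[OF fin]) (use card_mono[OF fin, of "{a \<in> verts S. odd (hd a) = p}"] in auto)
  have "arcs S = {}"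
  proof (rule ccontr)
    assume "arcs S \<noteq> {}"
    then obtain a b where ab: "(a, b) \<in> arcs S" by (metis ex_in_conv surj_pair)
    have "(a, b) \<in> parcs (balanced_hypercube (Suc m))" "tail S = fst" "head S = snd" "wf_digraph S"
      using S(1) ab by (auto simp: subgraph_def compatible_def)
    then have "odd (hd a) \<noteq> odd (hd b)" "a \<in> verts S" "b \<in> verts S"
      using parcs_balanced_hypercube_odd_hd[of a b m] ab
        wf_digraph.tail_in_verts[of S "(a, b)"] wf_digraph.head_in_verts[of S "(a, b)"] by auto
    then show False using eq by auto
  qed
  then have "card (verts S) \<le> 1"
    using connected_no_arcs[OF S(2)] card_le_Suc0_iff_eq[OF fin] by auto
  then show False using c3 eq by simp
qed

lemma substructure_cut_card_ge:
  assumes "m \<ge> 1" and H: "finite (verts H)" "card (verts H) \<le> 3"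
    and F: "finite F" "substructure_cut (with_proj (balanced_hypercube (Suc m))) H F"
  shows "Suc m \<le> card F"
proof (rule ccontr)
  let ?G = "with_proj (balanced_hypercube (Suc m))"
  assume "\<not> ?thesis"
  then have cF: "card F \<le> m" by simp
  define S where "S = (\<Union>T\<in>F. verts T)"
  have VG: "verts ?G = bh_verts (Suc m)" by (simp add: balanced_hypercube_def)
  have T: "subgraph T ?G" "connected T" "card (verts T) \<le> 3" if "T \<in> F" for T
    using F(2) that card_verts_substructure[OF _ _ H(1), of T] H(2)
    unfolding substructure_cut_def subgraph_cut_def by (blast intro: le_trans)+
  have vT: "verts T \<subseteq> bh_verts (Suc m)" if "T \<in> F" for T
    using T(1)[OF that] VG unfolding subgraph_def by simp
  have finT: "finite (verts T)" if "T \<in> F" for T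
    using vT[OF that] finite_bh_verts finite_subset by blast
  have S_sub: "S \<subseteq> bh_verts (Suc m)" using vT by (auto simp: S_def)
  then have finS: "finite S" using finite_bh_verts finite_subset by blast
  have "card S \<le> (\<Sum>T\<in>F. card (verts T))"
    unfolding S_def by (rule card_UN_le[OF F(1)])
  also have "\<dots> \<le> (\<Sum>T\<in>F. 3)" by (intro sum_mono T)
  finally have S3: "card S \<le> 3 * m" using cF by simp
  have Sp: "card {a \<in> S. odd (hd a) = p} \<le> 2 * m" for p
  proof -
    have eq: "{a \<in> S. odd (hd a) = p} = (\<Union>T\<in>F. {a \<in> verts T. odd (hd a) = p})"
      by (auto simp: S_def)
    have "card {a \<in> S. odd (hd a) = p} \<le> (\<Sum>T\<in>F. card {a \<in> verts T. odd (hd a) = p})"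
      unfolding eq by (rule card_UN_le[OF F(1)])
    also have "\<dots> \<le> (\<Sum>T\<in>F. 2)"
      using T finT by (intro sum_mono card_odd_hd_substructure)
    finally show ?thesis using cF by simp
  qed
  have split: "card S = card {a \<in> S. odd (hd a) = False} + card {a \<in> S. odd (hd a) = True}"
    using finS by (subst card_Un_disjoint[symmetric]) (auto intro!: arg_cong[where f = card])
  have D: "card (covered m S p) \<le> m" for p
    using card_covered[OF finS, of m p] Sp[of p] by simp
  \<comment> \<open>Twice the left side is at most \<open>3 * m\<close>. For \<open>m = 1\<close>
    the bound holds only because 3/2 rounds down to 1.\<close>
  have D2: "card (covered m S False) + card (covered m S True) \<le> 2 * m - 1"
    using card_covered[OF finS, of m True] card_covered[OF finS, of m False] split S3 assms(1)
    by linarith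
  \<comment> \<open>An empty remainder counts as disconnected, so a family covering all vertices has
    to be excluded by size.\<close>
  have "3 * m < 4 * 4 ^ m" by (induction m) auto
  then have "S \<noteq> bh_verts (Suc m)" using S3 card_bh_verts[of "Suc m"] by auto
  with S_sub have "S \<subset> bh_verts (Suc m)" by blast
  from connected_delete_balanced_hypercube[OF this D D2] F(2) show False
    unfolding substructure_cut_def subgraph_cut_def VG S_def Let_def by blast
qed

subsection \<open>The upper bound\<close>

text \<open>Without parallel arcs an arc is determined by its ends, so the vertex bijection induces
  the arc bijection; \<open>g\<close> recovers an arc of \<open>H\<close> from its ends.\<close>

lemma digraph_isoI_arcs_ends:
  assumes G: "nomulti_digraph G" and H: "nomulti_digraph H"
    and f: "bij_betw f (verts G) (verts H)"
    and ends: "map_prod f f ` arcs_ends G = arcs_ends H"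
  shows "digraph_iso G H"
proof -
  interpret G: nomulti_digraph G by (rule G)
  interpret H: nomulti_digraph H by (rule H)
  define g where "g = the_inv_into (arcs H) (arc_to_ends H)"
  have bG: "bij_betw (arc_to_ends G) (arcs G) (arcs_ends G)"
    using G.inj_on_arc_to_ends by (simp add: bij_betw_def arcs_ends_def)
  have bH: "bij_betw (arc_to_ends H) (arcs H) (arcs_ends H)"
    using H.inj_on_arc_to_ends by (simp add: bij_betw_def arcs_ends_def)
  have g: "bij_betw g (arcs_ends H) (arcs H)"
    unfolding g_def using bH by (rule bij_betw_the_inv_into)
  have ends_g: "arc_to_ends H (g e) = e" if "e \<in> arcs_ends H" for e
    unfolding g_def using bH that by (metis bij_betw_def f_the_inv_into_f)
  have "arcs_ends G \<subseteq> verts G \<times> verts G"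
    using G.adj_in_verts by auto
  moreover have "inj_on (map_prod f f) (verts G \<times> verts G)"
    using f by (auto simp: bij_betw_def inj_on_def)
  ultimately have "bij_betw (map_prod f f) (arcs_ends G) (arcs_ends H)"
    using ends by (auto simp: bij_betw_def intro: inj_on_subset)
  then have bh: "bij_betw (g \<circ> (map_prod f f \<circ> arc_to_ends G)) (arcs G) (arcs H)"
    using bG g by (blast intro: bij_betw_trans)
  define hom where "hom = \<lparr>iso_verts = f, iso_arcs = g \<circ> (map_prod f f \<circ> arc_to_ends G),
    iso_head = head H, iso_tail = tail H\<rparr>"
  have "(f (tail G a), f (head G a)) = arc_to_ends H (g (map_prod f f (arc_to_ends G a)))"
    if "a \<in> arcs G" for a
  proof -
    have "map_prod f f (arc_to_ends G a) \<in> arcs_ends H"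
      using that ends by (auto simp: arcs_ends_def)
    then show ?thesis using ends_g by (simp add: arc_to_ends_def)
  qed
  then have "G.digraph_isomorphism hom"
    unfolding G.digraph_isomorphism_def using f bh G.wf_digraph
    by (auto simp: hom_def bij_betw_def arc_to_ends_def)
  moreover have "H = app_iso hom G"
    using f bh by (simp add: app_iso_def hom_def bij_betw_def)
  ultimately show ?thesis unfolding digraph_iso_def by blast
qed

text \<open>Bijections between corresponding parts glue together. This identifies concrete stars
  with an arbitrary model \<open>H\<close> of \<open>K_{1,2}\<close>.\<close>

lemma complete_bipartite_digraph_unique:
  assumes G: "complete_bipartite_digraph m n G" and H: "complete_bipartite_digraph m n H"
  shows "digraph_iso G H"
proof -
  obtain U V where G': "graph G" "verts G = U \<union> V" "U \<inter> V = {}" "card U = m" "card V = n"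
    "arcs_ends G = U \<times> V \<union> V \<times> U"
    using G by (auto simp: complete_bipartite_digraph_def)
  obtain U' V' where H': "graph H" "verts H = U' \<union> V'" "U' \<inter> V' = {}" "card U' = m" "card V' = n"
    "arcs_ends H = U' \<times> V' \<union> V' \<times> U'"
    using H by (auto simp: complete_bipartite_digraph_def)
  interpret G: graph G by (rule G')
  interpret H: graph H by (rule H')
  have fin: "finite U" "finite V" "finite U'" "finite V'"
    using G.finite_verts H.finite_verts G' H' by auto
  obtain f g where f: "bij_betw f U U'" and g: "bij_betw g V V'"
    using fin G' H' by (metis finite_same_card_bij)
  define h where "h x = (if x \<in> U then f x else g x)" for x
  have hU: "bij_betw h U U'" using f by (subst bij_betw_cong[of U h f]) (auto simp: h_def)
  have hV: "bij_betw h V V'"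
    using g G'(3) by (subst bij_betw_cong[of V h g]) (auto simp: h_def)
  have "bij_betw h (verts G) (verts H)"
    unfolding G' H' using hU hV H'(3) by (rule bij_betw_combine)
  moreover have "map_prod h h ` arcs_ends G = arcs_ends H"
    unfolding G' H' image_Un using hU hV by (simp add: map_prod_surj_on bij_betw_def)
  ultimately show ?thesis
    using G.nomulti_digraph H.nomulti_digraph by (rule digraph_isoI_arcs_ends[rotated 2])
qed

lemma connected_complete_bipartite_digraph:
  assumes "complete_bipartite_digraph m n G" "m > 0" "n > 0"
  shows "connected G"
proof -
  obtain U V where G: "graph G" "verts G = U \<union> V" "U \<inter> V = {}" "card U = m" "card V = n"
    "arcs_ends G = U \<times> V \<union> V \<times> U"
    using assms by (auto simp: complete_bipartite_digraph_def)
  interpret graph G by (rule G)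
  obtain a b where ab: "a \<in> U" "b \<in> V"
    using assms(2,3) G(4,5) by (metis card.empty ex_in_conv less_irrefl)
  show ?thesis
  proof (rule connectedI)
    show "verts G \<noteq> {}" using ab G by auto
    fix u v assume uv: "u \<in> verts G" "v \<in> verts G"
    \<comment> \<open>For \<open>u\<close> and \<open>v\<close> in different parts \<open>w\<close>
      is \<open>u\<close>; otherwise it is \<open>a\<close> or \<open>b\<close>, whichever lies in
      the opposite part.\<close>
    have "\<exists>w. (u \<rightarrow>\<^bsub>G\<^esub> w \<or> u = w) \<and> w \<rightarrow>\<^bsub>G\<^esub> v"
      using uv ab unfolding G(2,6) by auto
    then have "u \<rightarrow>\<^sup>*\<^bsub>G\<^esub> v" using reachable_adjI adj_reachable_trans by blast
    then show "u \<rightarrow>\<^sup>*\<^bsub>mk_symmetric G\<^esub> v" by (rule reachable_mk_symmetricI)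
  qed
qed

section \<open>Stars with two leaves and the cut built from them\<close>

definition star2 :: "'a \<Rightarrow> 'a \<Rightarrow> 'a \<Rightarrow> ('a, 'a \<times> 'a) pre_digraph" where
  "star2 x y z = with_proj \<lparr>pverts = {x, y, z}, parcs = {x} \<times> {y, z} \<union> {y, z} \<times> {x}\<rparr>"

lemma complete_bipartite_star2:
  assumes "x \<noteq> y" "x \<noteq> z" "y \<noteq> z"
  shows "complete_bipartite_digraph 1 2 (star2 x y z)"
  unfolding star2_def complete_bipartite_digraph_pair_def
  by (intro conjI exI[of _ "{x}"] exI[of _ "{y, z}"]) (use assms in auto)

text \<open>The witness \<open>T\<close> is \<open>H\<close> itself.\<close>

lemma star2_substructure:
  assumes H: "complete_bipartite_digraph 1 2 H" and G: "pair_graph G"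
    and arcs: "(x, y) \<in> parcs G" "(x, z) \<in> parcs G" and "y \<noteq> z"
  shows "graph (star2 x y z)" "subgraph (star2 x y z) (with_proj G)" "connected (star2 x y z)"
    "\<exists>T. graph T \<and> subgraph T H \<and> connected T \<and> digraph_iso (star2 x y z) T"
proof -
  interpret G: pair_graph G by (rule G)
  have "x \<noteq> y" "x \<noteq> z" using arcs G.no_loops by fastforce+
  then have K: "complete_bipartite_digraph 1 2 (star2 x y z)"
    using \<open>y \<noteq> z\<close> by (rule complete_bipartite_star2)
  then show gr: "graph (star2 x y z)" by (simp add: complete_bipartite_digraph_def)
  interpret S: graph "star2 x y z" by (rule gr)
  have "(y, x) \<in> parcs G" "(z, x) \<in> parcs G"
    using arcs G.sym_arcs arcs_ends_symmetric[of "with_proj G"] by auto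
  moreover have "{x, y, z} \<subseteq> pverts G"
    using arcs G.adj_in_verts by auto
  ultimately show "subgraph (star2 x y z) (with_proj G)"
    using arcs by (intro subgraphI S.wf_digraph G.wf_digraph) (auto simp: star2_def)
  show "connected (star2 x y z)"
    using connected_complete_bipartite_digraph[OF K] by simp
  interpret H: graph H using H by (simp add: complete_bipartite_digraph_def)
  have "graph H" "subgraph H H" "connected H" "digraph_iso (star2 x y z) H"
    using H.graph_axioms H.subgraph_refl connected_complete_bipartite_digraph[OF H]
      complete_bipartite_digraph_unique[OF K H] by auto
  then show "\<exists>T. graph T \<and> subgraph T H \<and> connected T \<and> digraph_iso (star2 x y z) T" by blast
qed

lemma ex_substructure_cut:
  assumes H: "complete_bipartite_digraph 1 2 H"
  shows "\<exists>F. finite F \<and> substructure_cut (with_proj (balanced_hypercube (Suc m))) H F \<and> card F = Suc m"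
proof -
  let ?G = "with_proj (balanced_hypercube (Suc m))"
  \<comment> \<open>The vertex to be isolated is \<open>0 # zs\<close>. The common centre
    \<open>2 # zs\<close> is its twin, and the leaves \<open>1 # c\<close>, \<open>3 # c\<close> are
    a pair of its neighbours; \<open>False\<close> is the parity of 0 and 2.\<close>
  define zs where "zs = replicate m (0::int)"
  define P where "P c = star2 (2 # zs) (1 # c) (3 # c)" for c
  define F where "F = P ` quot_neighbours False zs"
  have zs: "zs \<in> bh_verts m" by (auto simp: zs_def bh_verts_def)
  have qv: "c \<in> bh_verts m" if "c \<in> quot_neighbours False zs" for c
    using quot_neighbours_in_verts[OF zs that] .
  have VG: "verts ?G = bh_verts (Suc m)" by (simp add: balanced_hypercube_def)
  have vP: "verts (P c) = {2 # zs, 1 # c, 3 # c}" for c by (simp add: P_def star2_def)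
  \<comment> \<open>The stars share their centre but not their leaves, so \<open>F\<close> has
    exactly as many elements as there are pairs.\<close>
  have inj: "inj P"
  proof (rule injI)
    fix c d assume "P c = P d"
    then have "{2 # zs, 1 # c, 3 # c} = {2 # zs, 1 # d, 3 # d}" using vP by metis
    then have "1 # c \<in> {2 # zs, 1 # d, 3 # d}" by blast
    then show "c = d" by simp
  qed
  have card: "finite F" "card F = Suc m"
    using card_quot_neighbours[OF zs, of False] inj by (auto simp: F_def card_image inj_on_subset)
  have P: "graph S \<and> subgraph S ?G \<and> connected S"
      "\<exists>T. graph T \<and> subgraph T H \<and> connected T \<and> digraph_iso S T" if "S \<in> F" for S
  proof -
    from that obtain c where c: "S = P c" "c \<in> quot_neighbours False zs" by (auto simp: F_def)
    have "(2 # zs, 1 # c) \<in> parcs (balanced_hypercube (Suc m))"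
      "(2 # zs, 3 # c) \<in> parcs (balanced_hypercube (Suc m))"
      using c zs qv by (auto simp: parcs_balanced_hypercube bh_verts_Cons)
    note * = star2_substructure[OF H pair_graph_balanced_hypercube this]
    show "graph S \<and> subgraph S ?G \<and> connected S"
      "\<exists>T. graph T \<and> subgraph T H \<and> connected T \<and> digraph_iso S T"
      unfolding c P_def using * by auto
  qed
  define R where "R = ?G \<restriction> (verts ?G - (\<Union>S\<in>F. verts S))"
  have oR: "0 # zs \<in> verts R"
    using zs by (auto simp: R_def balanced_hypercube_def bh_verts_Cons F_def vP)
  interpret G: pair_graph "balanced_hypercube (Suc m)"
    by (rule pair_graph_balanced_hypercube) simp
  interpret R: wf_digraph R unfolding R_def by (rule G.wellformed_induce_subgraph)
  have "induced_subgraph R ?G" unfolding R_def by (rule G.induced_induce) auto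
  then have symR: "symmetric R" using G.sym_arcs induced_graph_imp_symmetric by blast
  have isolated: "\<not> (0 # zs) \<rightarrow>\<^bsub>R\<^esub> w" for w
  proof
    assume w: "(0 # zs) \<rightarrow>\<^bsub>R\<^esub> w"
    then have wv: "w \<in> bh_verts (Suc m)" and wS: "w \<notin> (\<Union>S\<in>F. verts S)"
      using R.adj_in_verts(2)[OF w] VG by (auto simp: R_def)
    have wG: "(0 # zs, w) \<in> parcs (balanced_hypercube (Suc m))"
      using w dominates_induce_subgraphD unfolding R_def by fastforce
    obtain y c where y: "w = y # c" "y \<in> {0, 1, 2, 3}" "c \<in> bh_verts m"
      using wv by (rule bh_verts_SucE)
    then have "odd y" "c \<in> quot_neighbours False zs" using wG by (auto simp: parcs_balanced_hypercube)
    then have "w \<in> verts (P c)" "P c \<in> F" using y by (auto simp: vP F_def)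
    then show False using wS by blast
  qed
  \<comment> \<open>\<open>connected\<close> ignores directions; symmetry of \<open>R\<close> turns
    it into directed reachability, and \<open>0 # zs\<close> has no outgoing arc. It may be all that
    remains, as for \<open>m = 0\<close>, and then the second disjunct holds.\<close>
  have "\<not> connected R \<or> card (verts R) = 1"
  proof (cases "connected R")
    case True
    then have "strongly_connected R" using R.symmetric_connected_imp_strongly_connected symR by blast
    then have "v = 0 # zs" if "v \<in> verts R" for v
      using that oR isolated unfolding strongly_connected_def
      by (metis pre_digraph.converse_reachable_cases)
    then have "verts R = {0 # zs}" using oR by blast
    then show ?thesis by simp
  qed simp
  then have "substructure_cut ?G H F"
    unfolding substructure_cut_def subgraph_cut_def Let_def R_def using P by blast
  then show ?thesis using card by blast
qed

theorem theorem4: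
  fixes n :: nat and H :: "('c, 'd) pre_digraph"
  assumes "n \<ge> 2" and "complete_bipartite_digraph 1 2 H"
  shows "substructure_connectivity (with_proj (balanced_hypercube n)) H = enat n"
proof -
  obtain m where n: "n = Suc m" and m: "m \<ge> 1" using assms(1) by (cases n) auto
  obtain U V where UV: "graph H" "verts H = U \<union> V" "card U = 1" "card V = 2"
    using assms(2) by (auto simp: complete_bipartite_digraph_def)
  have fin: "finite (verts H)"
    using UV(1) by (simp add: graph_def digraph_def fin_digraph.finite_verts)
  have card: "card (verts H) \<le> 3" using card_Un_le[of U V] UV by simp
  obtain F where F: "finite F" "substructure_cut (with_proj (balanced_hypercube n)) H F" "card F = n"
    using ex_substructure_cut[OF assms(2), of m] n by blast
  show ?thesis
    unfolding substructure_connectivity_def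
  proof (rule antisym)
    show "(INF F\<in>{F. finite F \<and> substructure_cut (with_proj (balanced_hypercube n)) H F}. enat (card F)) \<le> enat n"
      using F by (intro INF_lower2[of F]) auto
    show "enat n \<le> (INF F\<in>{F. finite F \<and> substructure_cut (with_proj (balanced_hypercube n)) H F}. enat (card F))"
      using substructure_cut_card_ge[OF m fin card] n by (intro INF_greatest) auto
  qed
qed

end
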